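(* Let $L$ be an orthomodular lattice. (ii') A lattice ideal $I$ of $L$ is a p-ideal if and only if for all $x\in L$ $$x+_l(I+_l x)\subseteq I .$$ (iii') If $I$ is a p-ideal of $L$, then the congruence $\theta$ of $L$ corresponding to $I$ is given by: for all $x,y\in L$, $x\mathrel{\theta}y$ if and only if $x+_l y\in I$.
   Context: An orthomodular lattice (OML) is an algebra $(L,\lor,\land,',0,1)$ such that $(L,\lor,\land,0,1)$ is a bounded lattice, $'$ is an orthocomplementation ($x\land x'=0$, $x\lor x'=1$, $x''=x$, and $x\le y$ implies $y'\le x'$), and the orthomodular law holds: $x\le y$ implies $y=x\lor(y\land x')$. The operation $+_l$ is defined by $x+_l y:=(x\lor(x'\land y))\land(x'\lor y')$, and $x+_l(I+_l x):=\{x+_l(i+_l x)\mid i\in I\}$. A lattice ideal is a nonempty down-closed subset closed under finite joins. Elements $a,b\in L$ are perspective, $a\sim b$, if they have a common algebraic complement, i.e. there is $c\in L$ with $a\land c=b\land c=0$ and $a\lor c=b\lor c=1$. A lattice ideal $I$ is a p-ideal if $a\in I$ and $b\sim a$ imply $b\in I$. Congruences are congruences of the algebra $(L,\lor,\land,',0,1)$, and $[a]\theta$ is the $\theta$-class of $a$. It is well known that $\theta\mapsto[0]\theta$ is a bijection from the congruences of $L$ onto the p-ideals of $L$; the congruence corresponding to a p-ideal $I$ is the unique congruence $\theta$ with $[0]\theta=I$ (it is known that $x\mathrel{\theta}y$ iff $(x\lor y)\land(x'\lor y')\in I$). *)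

theory Defs
  imports Main "HOL-Library.Complemented_Lattices"
begin

unbundle lattice_syntax

text \<open>
  Orthomodular lattices are the library class \<open>orthomodular_lattice\<close>; the orthocomplement
  of \<open>x\<close> is \<open>- x\<close>. The class also carries a difference operation, but its axiom
  \<open>x - y = x \<sqinter> - y\<close> makes it definable, so it imposes no restriction.
\<close>

definition oml_add :: "'a::orthomodular_lattice \<Rightarrow> 'a \<Rightarrow> 'a" (infixl \<open>+\<^sub>l\<close> 65)
  where "x +\<^sub>l y = (x \<squnion> (- x \<sqinter> y)) \<sqinter> (- x \<squnion> - y)"

definition lattice_ideal :: "'a::lattice set \<Rightarrow> bool"
  where "lattice_ideal I \<longleftrightarrow>
    I \<noteq> {} \<and>
    (\<forall>a\<in>I. \<forall>b. b \<le> a \<longrightarrow> b \<in> I) \<and>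
    (\<forall>a\<in>I. \<forall>b\<in>I. a \<squnion> b \<in> I)"

definition perspective :: "'a::bounded_lattice \<Rightarrow> 'a \<Rightarrow> bool"
  where "perspective a b \<longleftrightarrow>
    (\<exists>c. a \<sqinter> c = \<bottom> \<and> b \<sqinter> c = \<bottom> \<and> a \<squnion> c = \<top> \<and> b \<squnion> c = \<top>)"

definition p_ideal :: "'a::bounded_lattice set \<Rightarrow> bool"
  where "p_ideal I \<longleftrightarrow>
    lattice_ideal I \<and> (\<forall>a b. a \<in> I \<and> perspective b a \<longrightarrow> b \<in> I)"

text \<open>Compatibility with the constants \<open>\<bottom>\<close> and \<open>\<top>\<close> is reflexivity.\<close>

definition oml_congruence :: "('a::orthomodular_lattice \<times> 'a) set \<Rightarrow> bool"
  where "oml_congruence \<theta> \<longleftrightarrow>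
    equiv UNIV \<theta> \<and>
    (\<forall>a b c d. (a, b) \<in> \<theta> \<and> (c, d) \<in> \<theta> \<longrightarrow> (a \<squnion> c, b \<squnion> d) \<in> \<theta>) \<and>
    (\<forall>a b c d. (a, b) \<in> \<theta> \<and> (c, d) \<in> \<theta> \<longrightarrow> (a \<sqinter> c, b \<sqinter> d) \<in> \<theta>) \<and>
    (\<forall>a b. (a, b) \<in> \<theta> \<longrightarrow> (- a, - b) \<in> \<theta>)"

text \<open>
  The image \<open>\<theta> `` {\<bottom>}\<close> is the \<open>\<theta>\<close>-class of \<open>\<bottom>\<close>. For every p-ideal \<open>I\<close> exactly one
  congruence has \<open>I\<close> as its class of \<open>\<bottom>\<close>; the description below is meaningful only for
  such \<open>I\<close>.
\<close>

definition congruence_of_ideal :: "'a::orthomodular_lattice set \<Rightarrow> ('a \<times> 'a) set"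
  where "congruence_of_ideal I = (THE \<theta>. oml_congruence \<theta> \<and> \<theta> `` {\<bottom>} = I)"

end

theory Submission
  imports Defs
begin

text \<open>
  Write \<open>I\<close> for a lattice ideal. The bridge between its perspectivity closure, the
  condition on \<open>+\<^sub>l\<close> and the congruences is closure under the Sasaki projections
  \<open>a \<mapsto> x \<sqinter> (- x \<squnion> a)\<close>, the projections that replace \<open>a \<mapsto> x \<sqinter> a\<close> in the absence
  of distributivity.

  The projection of \<open>a\<close> to \<open>x\<close> is perspective to an element below \<open>a\<close>
  (\<open>sasaki_projection_perspective\<close>), so p-ideals are closed under these projections. Conversely,
  if \<open>c\<close> is a common complement of \<open>a\<close> and \<open>b\<close>, then projecting \<open>a\<close> to \<open>- c\<close> gives \<open>- c\<close>, and
  projecting \<open>- c\<close> to \<open>b\<close> gives \<open>b\<close>, so a closed ideal that contains \<open>a\<close> contains \<open>b\<close>.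

  For every lattice ideal, ``\<open>x \<squnion> i = y \<squnion> i\<close> for some \<open>i \<in> I\<close>'' is an equivalence
  that respects joins and has \<open>I\<close> as its class of \<open>\<bottom>\<close>. Closure under Sasaki projections
  is what makes it respect orthocomplements, and therefore meets: if \<open>z = x \<squnion> i\<close>, then
  \<open>- x\<close> is the join of \<open>- z\<close> with \<open>- x \<sqinter> (x \<squnion> i)\<close>, the projection of \<open>i\<close> to \<open>- x\<close>. So each
  p-ideal is the class of \<open>\<bottom>\<close> of some congruence.

  The operation \<open>+\<^sub>l\<close> is a symmetric difference: \<open>x +\<^sub>l y\<close> is the join of the orthogonal
  elements \<open>x \<sqinter> - (x \<sqinter> y)\<close> and \<open>- x \<sqinter> y\<close>. Modulo any congruence it vanishes exactly when \<open>x\<close> and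
  \<open>y\<close> are congruent (\<open>oml_congruence_iff_oml_add\<close>). So a congruence is described by its class of
  \<open>\<bottom>\<close>, and the congruence of a p-ideal is unique. It follows that in a p-ideal all elements
  \<open>x +\<^sub>l (i +\<^sub>l x)\<close> with \<open>i \<in> I\<close> are present: modulo its congruence they become
  \<open>x +\<^sub>l x = \<bottom>\<close>. Conversely, \<open>x +\<^sub>l (i +\<^sub>l x)\<close> lies above the Sasaki projection of \<open>i\<close> to \<open>x\<close>
  (\<open>sasaki_projection_le_oml_add\<close>), so an ideal that contains all these elements is closed
  under Sasaki projections.
\<close>

section \<open>Orthomodular computations\<close>

lemma orthomodular_meet:
  fixes p q :: "'a::orthomodular_lattice"
  assumes "p \<le> - q"
  shows "- q \<sqinter> (p \<squnion> q) = p"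
proof -
  have "q \<le> - p"
    using assms by (metis compl_le_swap1)
  then have "q \<squnion> (- q \<sqinter> - p) = - p"
    by (rule orthomodular)
  then have "- (q \<squnion> (- q \<sqinter> - p)) = p"
    by simp
  then show ?thesis
    by (simp add: sup_commute)
qed

text \<open>
  A case of the Foulis--Holland theorem, since \<open>q\<close> commutes with \<open>x\<close> and with \<open>p\<close>. The
  direct proof splits the left side into \<open>q\<close> and its part orthogonal to \<open>q\<close>.
\<close>

lemma inf_sup_distrib_orthogonal:
  fixes p q x :: "'a::orthomodular_lattice"
  assumes "q \<le> x" and "p \<le> - q"
  shows "x \<sqinter> (p \<squnion> q) = (x \<sqinter> p) \<squnion> q"
proof -
  have "x \<sqinter> (p \<squnion> q) = q \<squnion> (- q \<sqinter> (x \<sqinter> (p \<squnion> q)))"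
    using assms(1) by (intro orthomodular [symmetric]) simp
  also have "- q \<sqinter> (x \<sqinter> (p \<squnion> q)) = x \<sqinter> (- q \<sqinter> (p \<squnion> q))"
    by (simp add: inf_left_commute)
  also have "\<dots> = x \<sqinter> p"
    using assms(2) by (simp add: orthomodular_meet)
  finally show ?thesis
    by (simp add: sup_commute)
qed

lemma oml_add_eq_sup:
  fixes x y :: "'a::orthomodular_lattice"
  shows "x +\<^sub>l y = (x \<sqinter> - (x \<sqinter> y)) \<squnion> (- x \<sqinter> y)"
proof -
  have "(- x \<squnion> - y) \<sqinter> (x \<squnion> (- x \<sqinter> y)) = ((- x \<squnion> - y) \<sqinter> x) \<squnion> (- x \<sqinter> y)"
    by (rule inf_sup_distrib_orthogonal) (auto intro: le_supI1 le_infI1)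
  then show ?thesis
    by (simp add: oml_add_def inf_commute)
qed

lemma oml_add_self:
  fixes x :: "'a::orthomodular_lattice"
  shows "x +\<^sub>l x = \<bottom>"
  by (simp add: oml_add_eq_sup)

lemma bot_oml_add:
  fixes x :: "'a::orthomodular_lattice"
  shows "\<bottom> +\<^sub>l x = x"
  by (simp add: oml_add_eq_sup)

text \<open>
  The difference between \<open>x\<close> and \<open>i +\<^sub>l x\<close> contains the part of \<open>x\<close> outside their meet.
  That meet is \<open>- i \<sqinter> x\<close>, because the other summand of \<open>i +\<^sub>l x\<close> is disjoint from \<open>x\<close>.
\<close>

lemma sasaki_projection_le_oml_add:
  fixes i x :: "'a::orthomodular_lattice"
  shows "x \<sqinter> (- x \<squnion> i) \<le> x +\<^sub>l (i +\<^sub>l x)"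
proof -
  have "x \<sqinter> (i +\<^sub>l x) = (x \<sqinter> (i \<sqinter> - (i \<sqinter> x))) \<squnion> (- i \<sqinter> x)"
    unfolding oml_add_eq_sup [of i x]
    by (rule inf_sup_distrib_orthogonal) (auto intro: le_infI1 le_supI1)
  also have "x \<sqinter> (i \<sqinter> - (i \<sqinter> x)) = (i \<sqinter> x) \<sqinter> - (i \<sqinter> x)"
    by (simp only: inf_commute inf_left_commute inf_assoc)
  also have "\<dots> = \<bottom>"
    by (rule inf_compl_bot)
  finally have "x \<sqinter> (i +\<^sub>l x) = - i \<sqinter> x"
    by simp
  then have "x \<sqinter> - (x \<sqinter> (i +\<^sub>l x)) = x \<sqinter> (- x \<squnion> i)"
    by (simp add: sup_commute)
  then show ?thesis
    by (metis oml_add_eq_sup sup_ge1)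
qed

section \<open>Perspectivity and Sasaki projections\<close>

text \<open>
  This is the parallelogram law: the two elements are the relative complements of \<open>- x\<close> in
  \<open>a \<squnion> - x\<close> and of \<open>a \<sqinter> - x\<close> in \<open>a\<close>. The orthocomplement of the first is a complement of both.
\<close>

lemma sasaki_projection_perspective:
  fixes a x :: "'a::orthomodular_lattice"
  shows "perspective (x \<sqinter> (- x \<squnion> a)) (a \<sqinter> - (a \<sqinter> - x))"
proof -
  define e where "e = x \<sqinter> (- x \<squnion> a)"
  define f where "f = a \<sqinter> - (a \<sqinter> - x)"
  define s where "s = - x \<squnion> a"
  have compl_e: "- e = - x \<squnion> - s"
    by (simp add: e_def s_def)
  have "f \<sqinter> - e = \<bottom>"
  proof -
    have "s \<sqinter> (- x \<squnion> - s) = - x"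
      using orthomodular_meet [of "- x" "- s"] by (simp add: s_def)
    moreover have "f \<le> s"
      by (auto simp: f_def s_def intro: le_infI1 le_supI2)
    ultimately have "f \<sqinter> - e = f \<sqinter> - x"
      unfolding compl_e using inf_assoc [of f s "- x \<squnion> - s"] by (simp only: inf.absorb1)
    also have "\<dots> = (a \<sqinter> - x) \<sqinter> - (a \<sqinter> - x)"
      unfolding f_def by (simp only: inf_commute inf_left_commute inf_assoc)
    also have "\<dots> = \<bottom>"
      by (rule inf_compl_bot)
    finally show ?thesis .
  qed
  moreover have "f \<squnion> - e = \<top>"
  proof -
    have "(a \<sqinter> - x) \<squnion> f = a"
      using orthomodular [of "a \<sqinter> - x" a] by (simp add: f_def inf_commute)
    moreover have "a \<sqinter> - x \<le> - e"
      by (auto simp: compl_e intro: le_infI2 le_supI1)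
    ultimately have "a \<le> f \<squnion> - e"
      using sup_mono [of "a \<sqinter> - x" "- e" f f] by (simp add: sup_commute)
    then have "s \<le> f \<squnion> - e"
      by (auto simp: s_def compl_e intro: le_supI2)
    moreover have "- s \<le> f \<squnion> - e"
      by (auto simp: compl_e intro: le_supI2)
    ultimately have "s \<squnion> - s \<le> f \<squnion> - e"
      by (rule le_supI)
    then show ?thesis
      by (simp only: sup_compl_top top_unique)
  qed
  ultimately have "perspective e f"
    unfolding perspective_def by (intro exI [of _ "- e"]) simp
  then show ?thesis
    by (simp add: e_def f_def)
qed

lemma p_ideal_iff_sasaki_closed:
  fixes I :: "'a::orthomodular_lattice set"
  assumes "lattice_ideal I"
  shows "p_ideal I \<longleftrightarrow> (\<forall>x. \<forall>a\<in>I. x \<sqinter> (- x \<squnion> a) \<in> I)"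
proof
  assume p: "p_ideal I"
  show "\<forall>x. \<forall>a\<in>I. x \<sqinter> (- x \<squnion> a) \<in> I"
  proof (intro allI ballI)
    fix x a
    assume "a \<in> I"
    then have "a \<sqinter> - (a \<sqinter> - x) \<in> I"
      using assms unfolding lattice_ideal_def by (meson inf_le1)
    then show "x \<sqinter> (- x \<squnion> a) \<in> I"
      using p sasaki_projection_perspective unfolding p_ideal_def by blast
  qed
next
  assume closed: "\<forall>x. \<forall>a\<in>I. x \<sqinter> (- x \<squnion> a) \<in> I"
  have "b \<in> I" if "a \<in> I" and "perspective b a" for a b
  proof -
    obtain c where "b \<sqinter> c = \<bottom>" and "a \<squnion> c = \<top>"
      using \<open>perspective b a\<close> unfolding perspective_def by blast
    have "- c \<sqinter> (- (- c) \<squnion> a) = - c"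
      using \<open>a \<squnion> c = \<top>\<close> by (simp add: sup_commute)
    then have "- c \<in> I"
      using closed \<open>a \<in> I\<close> by metis
    moreover have "b \<sqinter> (- b \<squnion> - c) = b"
      using \<open>b \<sqinter> c = \<bottom>\<close> by (metis compl_inf compl_bot_eq inf_top_right)
    ultimately show "b \<in> I"
      using closed by metis
  qed
  then show "p_ideal I"
    using assms unfolding p_ideal_def by blast
qed

section \<open>Congruences and their kernels\<close>

text \<open>
  If \<open>x +\<^sub>l y\<close> is congruent to \<open>\<bottom>\<close>, then so are both its summands, and this makes \<open>x\<close> and \<open>y\<close>
  congruent to \<open>x \<sqinter> y\<close>. The equivalence shows that the class of \<open>\<bottom>\<close> determines \<open>\<theta>\<close>.
\<close>

lemma oml_congruence_iff_oml_add:
  fixes \<theta> :: "('a::orthomodular_lattice \<times> 'a) set"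
  assumes "oml_congruence \<theta>"
  shows "(x, y) \<in> \<theta> \<longleftrightarrow> (\<bottom>, x +\<^sub>l y) \<in> \<theta>"
proof -
  have refl: "(a, a) \<in> \<theta>" for a
    using assms unfolding oml_congruence_def equiv_def refl_on_def by blast
  have sym: "(b, a) \<in> \<theta>" if "(a, b) \<in> \<theta>" for a b
    using assms that unfolding oml_congruence_def equiv_def by (meson symD)
  have trans: "(a, c) \<in> \<theta>" if "(a, b) \<in> \<theta>" and "(b, c) \<in> \<theta>" for a b c
    using assms that unfolding oml_congruence_def equiv_def by (meson transD)
  have sup: "(a \<squnion> c, b \<squnion> d) \<in> \<theta>" if "(a, b) \<in> \<theta>" and "(c, d) \<in> \<theta>" for a b c d
    using assms that unfolding oml_congruence_def by blast
  have inf: "(a \<sqinter> c, b \<sqinter> d) \<in> \<theta>" if "(a, b) \<in> \<theta>" and "(c, d) \<in> \<theta>" for a b c d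
    using assms that unfolding oml_congruence_def by blast
  have compl: "(- a, - b) \<in> \<theta>" if "(a, b) \<in> \<theta>" for a b
    using assms that unfolding oml_congruence_def by blast
  show ?thesis
  proof
    assume "(x, y) \<in> \<theta>"
    then have "(x +\<^sub>l x, x +\<^sub>l y) \<in> \<theta>"
      unfolding oml_add_def by (intro sup inf compl refl)
    then show "(\<bottom>, x +\<^sub>l y) \<in> \<theta>"
      by (simp add: oml_add_self)
  next
    assume zero: "(\<bottom>, x +\<^sub>l y) \<in> \<theta>"
    have below: "(\<bottom>, a) \<in> \<theta>" if "a \<le> x +\<^sub>l y" for a
      using inf [OF refl [of a] zero] that by (simp add: inf.absorb1)
    define m where "m = x \<sqinter> y"
    have "(\<bottom>, x \<sqinter> - m) \<in> \<theta>"
      by (rule below) (simp add: oml_add_eq_sup m_def)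
    from sup [OF refl [of m] this] have m_x: "(m, x) \<in> \<theta>"
      using orthomodular [of m x] by (simp add: m_def inf_commute)
    \<comment> \<open>Hence the two relative complements \<open>- m \<sqinter> y\<close> and \<open>- x \<sqinter> y\<close> are congruent as well.\<close>
    have "(\<bottom>, - x \<sqinter> y) \<in> \<theta>"
      by (rule below) (simp add: oml_add_eq_sup)
    moreover have "(- x \<sqinter> y, - m \<sqinter> y) \<in> \<theta>"
      by (rule inf [OF compl [OF sym [OF m_x]] refl])
    ultimately have "(\<bottom>, - m \<sqinter> y) \<in> \<theta>"
      by (rule trans)
    from sup [OF refl [of m] this] have "(m, y) \<in> \<theta>"
      using orthomodular [of m y] by (simp add: m_def)
    then show "(x, y) \<in> \<theta>"
      using m_x sym trans by blast
  qed
qed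

text \<open>
  In contrast to the description by \<open>+\<^sub>l\<close>, this form makes transitivity and compatibility
  with joins immediate.
\<close>

definition ideal_relation :: "'a::lattice set \<Rightarrow> ('a \<times> 'a) set"
  where "ideal_relation I = {(x, y). \<exists>i\<in>I. x \<squnion> i = y \<squnion> i}"

lemma ideal_relation_kernel:
  fixes I :: "'a::bounded_lattice set"
  assumes "lattice_ideal I"
  shows "ideal_relation I `` {\<bottom>} = I"
proof -
  have "(\<bottom>, y) \<in> ideal_relation I \<longleftrightarrow> (\<exists>i\<in>I. y \<le> i)" for y
    by (auto simp: ideal_relation_def le_iff_sup eq_commute)
  moreover have "(\<exists>i\<in>I. y \<le> i) \<longleftrightarrow> y \<in> I" for y
    using assms by (auto simp: lattice_ideal_def)
  ultimately show ?thesis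
    by auto
qed

lemma ideal_relation_equiv:
  assumes "lattice_ideal I"
  shows "equiv UNIV (ideal_relation I)"
proof (rule equivI)
  show "refl (ideal_relation I)"
    using assms by (auto simp: refl_on_def ideal_relation_def lattice_ideal_def)
  show "sym (ideal_relation I)"
    by (auto simp: sym_def ideal_relation_def) (metis)
  show "trans (ideal_relation I)"
  proof (rule transI)
    fix x y z
    assume "(x, y) \<in> ideal_relation I" and "(y, z) \<in> ideal_relation I"
    then obtain i j where "i \<in> I" "j \<in> I" "x \<squnion> i = y \<squnion> i" "y \<squnion> j = z \<squnion> j"
      by (auto simp: ideal_relation_def)
    then have "x \<squnion> (i \<squnion> j) = z \<squnion> (i \<squnion> j)"
      by (metis sup_assoc sup_commute)
    moreover have "i \<squnion> j \<in> I"
      using assms \<open>i \<in> I\<close> \<open>j \<in> I\<close> by (simp add: lattice_ideal_def)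
    ultimately show "(x, z) \<in> ideal_relation I"
      by (auto simp: ideal_relation_def)
  qed
qed auto

lemma ideal_relation_sup:
  assumes "lattice_ideal I"
    and "(a, b) \<in> ideal_relation I" and "(c, d) \<in> ideal_relation I"
  shows "(a \<squnion> c, b \<squnion> d) \<in> ideal_relation I"
proof -
  obtain i j where "i \<in> I" "j \<in> I" "a \<squnion> i = b \<squnion> i" "c \<squnion> j = d \<squnion> j"
    using assms(2,3) by (auto simp: ideal_relation_def)
  then have "(a \<squnion> i) \<squnion> (c \<squnion> j) = (b \<squnion> i) \<squnion> (d \<squnion> j)"
    by simp
  then have "(a \<squnion> c) \<squnion> (i \<squnion> j) = (b \<squnion> d) \<squnion> (i \<squnion> j)"
    by (simp only: sup_assoc sup_commute sup_left_commute)
  moreover have "i \<squnion> j \<in> I"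
    using assms(1) \<open>i \<in> I\<close> \<open>j \<in> I\<close> by (simp add: lattice_ideal_def)
  ultimately show ?thesis
    by (auto simp: ideal_relation_def)
qed

text \<open>
  It suffices to compare \<open>x\<close> with \<open>x \<squnion> i\<close>: the orthocomplements then differ by
  the Sasaki projection of \<open>i\<close> to \<open>- x\<close>, which lies in \<open>I\<close>.
\<close>

lemma ideal_relation_compl:
  fixes I :: "'a::orthomodular_lattice set"
  assumes "p_ideal I" and "(x, y) \<in> ideal_relation I"
  shows "(- x, - y) \<in> ideal_relation I"
proof -
  have ideal: "lattice_ideal I"
    using assms(1) by (simp add: p_ideal_def)
  obtain i where "i \<in> I" and eq: "x \<squnion> i = y \<squnion> i"
    using assms(2) by (auto simp: ideal_relation_def)
  have step: "(- a, - (a \<squnion> i)) \<in> ideal_relation I" for a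
  proof -
    define j where "j = - a \<sqinter> (a \<squnion> i)"
    have "- a \<sqinter> (- (- a) \<squnion> i) \<in> I"
      using assms(1) \<open>i \<in> I\<close> p_ideal_iff_sasaki_closed [OF ideal] by blast
    then have "j \<in> I"
      by (simp add: j_def)
    moreover have "- (a \<squnion> i) \<squnion> j = - a"
      using orthomodular [of "- (a \<squnion> i)" "- a"] by (simp add: j_def inf_commute)
    moreover have "- a \<squnion> j = - a"
      by (simp add: j_def sup.absorb1)
    ultimately have "\<exists>j\<in>I. - a \<squnion> j = - (a \<squnion> i) \<squnion> j"
      by metis
    then show ?thesis
      unfolding ideal_relation_def by blast
  qed
  have "(- (x \<squnion> i), - y) \<in> ideal_relation I"
    using step [of y] eq ideal_relation_equiv [OF ideal]
    by (metis equiv_def symD)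
  then show ?thesis
    using step [of x] ideal_relation_equiv [OF ideal]
    by (meson equiv_def transD)
qed

lemma ideal_relation_congruence:
  fixes I :: "'a::orthomodular_lattice set"
  assumes "p_ideal I"
  shows "oml_congruence (ideal_relation I)"
proof -
  have ideal: "lattice_ideal I"
    using assms by (simp add: p_ideal_def)
  have "(a \<sqinter> c, b \<sqinter> d) \<in> ideal_relation I"
    if "(a, b) \<in> ideal_relation I" and "(c, d) \<in> ideal_relation I" for a b c d
  proof -
    have "(- (- a \<squnion> - c), - (- b \<squnion> - d)) \<in> ideal_relation I"
      by (rule ideal_relation_compl [OF assms ideal_relation_sup [OF ideal]])
        (rule ideal_relation_compl [OF assms that(1)] ideal_relation_compl [OF assms that(2)])+
    then show ?thesis
      by simp
  qed
  then show ?thesis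
    unfolding oml_congruence_def
    using ideal_relation_equiv [OF ideal] ideal_relation_sup [OF ideal]
      ideal_relation_compl [OF assms]
    by blast
qed

lemma congruence_of_ideal_eq:
  fixes I :: "'a::orthomodular_lattice set"
  assumes "oml_congruence \<theta>" and "\<theta> `` {\<bottom>} = I"
  shows "congruence_of_ideal I = \<theta>"
  unfolding congruence_of_ideal_def
proof (rule the_equality)
  have add_iff: "(x, y) \<in> \<phi> \<longleftrightarrow> x +\<^sub>l y \<in> I"
    if "oml_congruence \<phi>" and "\<phi> `` {\<bottom>} = I" for \<phi> and x y :: 'a
    unfolding that(2) [symmetric] Image_singleton_iff
    by (rule oml_congruence_iff_oml_add [OF that(1)])
  fix \<theta>'
  assume "oml_congruence \<theta>' \<and> \<theta>' `` {\<bottom>} = I"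
  then have "(x, y) \<in> \<theta>' \<longleftrightarrow> (x, y) \<in> \<theta>" for x y
    using add_iff assms by simp
  then show "\<theta>' = \<theta>"
    by (intro set_eqI) (simp add: split_paired_all)
qed (use assms in simp)

lemma congruence_of_p_ideal:
  fixes I :: "'a::orthomodular_lattice set"
  assumes "p_ideal I"
  shows "oml_congruence (congruence_of_ideal I)" and "congruence_of_ideal I `` {\<bottom>} = I"
proof -
  have kernel: "ideal_relation I `` {\<bottom>} = I"
    using assms by (simp add: ideal_relation_kernel p_ideal_def)
  have "congruence_of_ideal I = ideal_relation I"
    by (rule congruence_of_ideal_eq [OF ideal_relation_congruence [OF assms] kernel])
  then show "oml_congruence (congruence_of_ideal I)" and "congruence_of_ideal I `` {\<bottom>} = I"
    using ideal_relation_congruence [OF assms] kernel by simp_all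
qed

lemma congruence_of_p_ideal_iff:
  fixes I :: "'a::orthomodular_lattice set"
  assumes "p_ideal I"
  shows "(x, y) \<in> congruence_of_ideal I \<longleftrightarrow> x +\<^sub>l y \<in> I"
  using oml_congruence_iff_oml_add [OF congruence_of_p_ideal(1) [OF assms], of x y]
    congruence_of_p_ideal(2) [OF assms]
  by blast

section \<open>The characterisations by \<open>+\<^sub>l\<close>\<close>

theorem proposition16:
  fixes I :: "'a::orthomodular_lattice set"
  shows "(lattice_ideal I \<longrightarrow>
            (p_ideal I \<longleftrightarrow> (\<forall>x. {x +\<^sub>l (i +\<^sub>l x) | i. i \<in> I} \<subseteq> I))) \<and>
         (p_ideal I \<longrightarrow>
            (\<forall>x y. (x, y) \<in> congruence_of_ideal I \<longleftrightarrow> x +\<^sub>l y \<in> I))"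
proof (intro conjI impI)
  assume ideal: "lattice_ideal I"
  show "p_ideal I \<longleftrightarrow> (\<forall>x. {x +\<^sub>l (i +\<^sub>l x) | i. i \<in> I} \<subseteq> I)"
  proof
    assume p: "p_ideal I"
    have "x +\<^sub>l (i +\<^sub>l x) \<in> I" if "i \<in> I" for x i
    proof -
      have cong: "oml_congruence (congruence_of_ideal I)"
        by (rule congruence_of_p_ideal(1) [OF p])
      then have refl: "(a, a) \<in> congruence_of_ideal I" for a
        unfolding oml_congruence_def equiv_def refl_on_def by blast
      have "(\<bottom>, i) \<in> congruence_of_ideal I"
        using congruence_of_p_ideal(2) [OF p] that by blast
      then have "(\<bottom> +\<^sub>l x, i +\<^sub>l x) \<in> congruence_of_ideal I"
        using cong refl unfolding oml_add_def oml_congruence_def by meson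
      then show ?thesis
        by (simp add: bot_oml_add congruence_of_p_ideal_iff [OF p])
    qed
    then show "\<forall>x. {x +\<^sub>l (i +\<^sub>l x) | i. i \<in> I} \<subseteq> I"
      by blast
  next
    assume closed: "\<forall>x. {x +\<^sub>l (i +\<^sub>l x) | i. i \<in> I} \<subseteq> I"
    have "x \<sqinter> (- x \<squnion> i) \<in> I" if "i \<in> I" for x i
    proof -
      have "x +\<^sub>l (i +\<^sub>l x) \<in> I"
        using closed that by blast
      then show ?thesis
        using ideal sasaki_projection_le_oml_add unfolding lattice_ideal_def by blast
    qed
    then show "p_ideal I"
      by (simp add: p_ideal_iff_sasaki_closed [OF ideal])
  qed
next
  assume "p_ideal I"
  then show "\<forall>x y. (x, y) \<in> congruence_of_ideal I \<longleftrightarrow> x +\<^sub>l y \<in> I"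
    by (simp add: congruence_of_p_ideal_iff)
qed

end
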